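(* Let $n\in\mathbb{N}$, let $\mathbb{X}=\ell_\infty^n$ (over $\mathbb{R}$) and $T\in S_{\mathbb{L}(\mathbb{X},\mathbb{X})}$. Then $T$ is an isometry if and only if there exists $\epsilon_0>0$ such that for each $0<\epsilon<\epsilon_0$, $T$ is the only uniform $\epsilon$-BPB approximation of $T$. Moreover, for every $n\in\mathbb{N}$ the pair $(\ell_\infty^n,\ell_\infty^n)$ has the non-trivial norm preserving uniform BPB approximation property.
   Context: $\mathbb{L}(\mathbb{X},\mathbb{Y})$ is the space of bounded linear operators with the operator norm; $S_Z$ is the unit sphere of a normed space $Z$; $\mathrm{Iso}(\mathbb{X},\mathbb{Y})$ is the (possibly empty) set of linear isometries from $\mathbb{X}$ to $\mathbb{Y}$. For $A\in\mathbb{L}(\mathbb{X},\mathbb{Y})$, $M_A=\{x\in S_{\mathbb{X}}:\|Ax\|=\|A\|\}$. For $T\in S_{\mathbb{L}(\mathbb{X},\mathbb{Y})}$ and $\epsilon>0$, an operator $A\in S_{\mathbb{L}(\mathbb{X},\mathbb{Y})}$ is a uniform $\epsilon$-BPB approximation of $T$ if $\|T-A\|<\epsilon$ and there exists $\delta(\epsilon)>0$ such that for each $x_0\in S_{\mathbb{X}}$ with $\|Tx_0\|>1-\delta(\epsilon)$ there exists $u_0\in M_A$ with $\|u_0-x_0\|<\epsilon$. It is non-trivial if in addition $A\neq T$. The pair $(\mathbb{X},\mathbb{Y})$ has the non-trivial norm preserving uniform BPB approximation property if for every $T\in S_{\mathbb{L}(\mathbb{X},\mathbb{Y})}\setminus\mathrm{Iso}(\mathbb{X},\mathbb{Y})$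 and every $\epsilon>0$, $T$ admits a non-trivial uniform $\epsilon$-BPB approximation $A_\epsilon$ with $M_T=M_{A_\epsilon}$. *)

theory Defs
  imports "HOL-Analysis.Analysis"
begin

(* The real space l_infty^n with n = CARD('n).  It is a copy of real ^ 'n, because
   the type real ^ 'n itself carries the Euclidean norm; infnorm is the library's
   supremum norm, see linf_norm_eq_Max below. *)

typedef 'n linf = "UNIV :: (real ^ 'n) set"
  morphisms vec_of_linf linf_of_vec
  by simp

setup_lifting type_definition_linf

instantiation linf :: (finite) real_vector
begin

lift_definition zero_linf :: "'a linf" is 0 .
lift_definition plus_linf :: "'a linf \<Rightarrow> 'a linf \<Rightarrow> 'a linf" is "(+)" .
lift_definition minus_linf :: "'a linf \<Rightarrow> 'a linf \<Rightarrow> 'a linf" is "(-)" .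
lift_definition uminus_linf :: "'a linf \<Rightarrow> 'a linf" is uminus .
lift_definition scaleR_linf :: "real \<Rightarrow> 'a linf \<Rightarrow> 'a linf" is scaleR .

instance
proof
  fix x y z :: "'a linf" and a b :: real
  show "x + y + z = x + (y + z)" by transfer simp
  show "x + y = y + x" by transfer simp
  show "0 + x = x" by transfer simp
  show "- x + x = 0" by transfer simp
  show "x - y = x + - y" by transfer simp
  show "a *\<^sub>R (x + y) = a *\<^sub>R x + a *\<^sub>R y" by transfer (simp add: scaleR_add_right)
  show "(a + b) *\<^sub>R x = a *\<^sub>R x + b *\<^sub>R x" by transfer (simp add: scaleR_add_left)
  show "a *\<^sub>R b *\<^sub>R x = (a * b) *\<^sub>R x" by transfer simp
  show "1 *\<^sub>R x = x" by transfer simp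
qed

end

instantiation linf :: (finite) real_normed_vector
begin

lift_definition norm_linf :: "'a linf \<Rightarrow> real" is infnorm .

definition dist_linf :: "'a linf \<Rightarrow> 'a linf \<Rightarrow> real"
  where "dist_linf x y = norm (x - y)"

definition sgn_linf :: "'a linf \<Rightarrow> 'a linf"
  where "sgn_linf x = x /\<^sub>R norm x"

definition uniformity_linf :: "('a linf \<times> 'a linf) filter"
  where "uniformity_linf = (INF e\<in>{0<..}. principal {(x, y). dist x y < e})"

definition open_linf :: "'a linf set \<Rightarrow> bool"
  where "open_linf U \<longleftrightarrow> (\<forall>x\<in>U. eventually (\<lambda>(x', y). x' = x \<longrightarrow> y \<in> U) uniformity)"

instance
proof
  fix x y :: "'a linf" and a :: real
  show "dist x y = norm (x - y)" by (rule dist_linf_def)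
  show "sgn x = x /\<^sub>R norm x" by (rule sgn_linf_def)
  show "(uniformity :: ('a linf \<times> 'a linf) filter) = (INF e\<in>{0<..}. principal {(x, y). dist x y < e})"
    by (rule uniformity_linf_def)
  show "open U \<longleftrightarrow> (\<forall>x\<in>U. eventually (\<lambda>(x', y). x' = x \<longrightarrow> y \<in> U) uniformity)" for U :: "'a linf set"
    by (rule open_linf_def)
  show "norm x = 0 \<longleftrightarrow> x = 0" by transfer (rule infnorm_eq_0)
  show "norm (x + y) \<le> norm x + norm y" by transfer (rule infnorm_triangle)
  show "norm (a *\<^sub>R x) = \<bar>a\<bar> * norm x" by transfer (rule infnorm_mul)
qed

end

lemma linf_norm_eq_Max: "norm x = (MAX i. \<bar>vec_of_linf x $ i\<bar>)"
proof -
  have "{\<bar>vec_of_linf x $ i\<bar> | i. i \<in> UNIV} = range (\<lambda>i. \<bar>vec_of_linf x $ i\<bar>)"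
    by auto
  then show ?thesis
    by (simp add: norm_linf.rep_eq infnorm_cart cSup_eq_Max)
qed

definition Iso :: "('a::real_normed_vector \<Rightarrow>\<^sub>L 'b::real_normed_vector) set"
  where "Iso = {T. \<forall>x. norm (blinfun_apply T x) = norm x}"

definition norm_attainment_set :: "('a::real_normed_vector \<Rightarrow>\<^sub>L 'b::real_normed_vector) \<Rightarrow> 'a set"
  where "norm_attainment_set A = {x \<in> sphere 0 1. norm (blinfun_apply A x) = norm A}"

(* Used only for T in the unit sphere and \<epsilon> > 0. *)
definition uniform_BPB_approx ::
    "real \<Rightarrow> ('a::real_normed_vector \<Rightarrow>\<^sub>L 'b::real_normed_vector) \<Rightarrow> ('a \<Rightarrow>\<^sub>L 'b) \<Rightarrow> bool"
  where "uniform_BPB_approx \<epsilon> T A \<longleftrightarrow>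
    A \<in> sphere 0 1 \<and> norm (T - A) < \<epsilon> \<and>
    (\<exists>\<delta>>0. \<forall>x0\<in>sphere 0 1. norm (blinfun_apply T x0) > 1 - \<delta> \<longrightarrow>
      (\<exists>u0\<in>norm_attainment_set A. norm (u0 - x0) < \<epsilon>))"

definition nontrivial_uniform_BPB_approx ::
    "real \<Rightarrow> ('a::real_normed_vector \<Rightarrow>\<^sub>L 'b::real_normed_vector) \<Rightarrow> ('a \<Rightarrow>\<^sub>L 'b) \<Rightarrow> bool"
  where "nontrivial_uniform_BPB_approx \<epsilon> T A \<longleftrightarrow> uniform_BPB_approx \<epsilon> T A \<and> A \<noteq> T"

(* The two spaces of the pair are passed as types. *)
definition nontrivial_norm_preserving_uniform_BPB_property ::
    "'a::real_normed_vector itself \<Rightarrow> 'b::real_normed_vector itself \<Rightarrow> bool"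
  where "nontrivial_norm_preserving_uniform_BPB_property _ _ \<longleftrightarrow>
    (\<forall>T :: 'a \<Rightarrow>\<^sub>L 'b. T \<in> sphere 0 1 - Iso \<longrightarrow>
      (\<forall>\<epsilon>>0. \<exists>A. nontrivial_uniform_BPB_approx \<epsilon> T A \<and>
        norm_attainment_set T = norm_attainment_set A))"

end

theory Submission
  imports Defs
begin

text \<open>
  Read an operator \<open>T\<close> of norm one on \<open>\<ell>\<^sub>\<infinity>\<^sup>n\<close> as a family of row functionals \<open>t\<^sub>i\<close> bounded by the norm;
  \<open>T\<close> attains its norm exactly where some row has modulus one. Replacing one row \<open>t\<^sub>i\<close> by
  \<open>(1 - \<eta>) t\<^sub>i + \<eta> w\<close> does not change the set of attainment if, wherever \<open>\<bar>t\<^sub>i\<bar>\<close> is one,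
  either \<open>w = t\<^sub>i\<close> or another row has modulus one. If row \<open>i\<close> is redundant any \<open>w\<close> of norm at most
  one will do, and if \<open>t\<^sub>i\<close> has a nonzero entry in column \<open>j\<close> the signed coordinate functional
  \<open>w = sgn (t\<^sub>i e\<^sub>j) e\<^sub>j\<^sup>*\<close> will do. All these replacements are trivial only if the rows are distinct signed
  coordinate functionals, that is, if \<open>T\<close> is an isometry. The \<open>\<delta>\<close> comes from compactness of the
  sphere.

  Conversely, if \<open>T\<close> is an isometry and \<open>A\<close> an approximation of it, then \<open>B = T\<^sup>-\<^sup>1 A\<close> is close to the
  identity and attains its norm close to every \<open>e\<^sub>i\<close>. This can only happen in row \<open>i\<close>, and forces
  that row to be \<open>e\<^sub>i\<^sup>*\<close>.
\<close>

section \<open>Coordinates of \<open>\<ell>\<^sub>\<infinity>\<^sup>n\<close>\<close>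

definition coord :: "'n::finite linf \<Rightarrow> 'n \<Rightarrow> real"
  where "coord x i = vec_of_linf x $ i"

definition unit :: "'n::finite \<Rightarrow> 'n linf"
  where "unit i = linf_of_vec (axis i 1)"

lemma coord_simps [simp]:
  "coord (x + y) i = coord x i + coord y i"
  "coord (x - y) i = coord x i - coord y i"
  "coord (- x) i = - coord x i"
  "coord (a *\<^sub>R x) i = a * coord x i"
  "coord 0 i = 0"
  by (simp_all add: coord_def plus_linf.rep_eq minus_linf.rep_eq uminus_linf.rep_eq
      scaleR_linf.rep_eq zero_linf.rep_eq)

lemma coord_unit: "coord (unit j) i = (if i = j then 1 else 0)"
  by (auto simp: coord_def unit_def linf_of_vec_inverse axis_def)

lemma linf_eqI: "(\<And>i. coord x i = coord y i) \<Longrightarrow> x = y"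
  by (metis coord_def vec_eq_iff vec_of_linf_inject)

lemma abs_coord_le: "\<bar>coord x i\<bar> \<le> norm x"
  unfolding linf_norm_eq_Max coord_def by (rule Max_ge) auto

lemma norm_linf_leI: "(\<And>i. \<bar>coord x i\<bar> \<le> c) \<Longrightarrow> norm x \<le> c"
  unfolding linf_norm_eq_Max coord_def by (subst Max_le_iff) auto

lemma norm_linf_attained: obtains i where "\<bar>coord x i\<bar> = norm x"
proof -
  have "norm x \<in> range (\<lambda>i. \<bar>vec_of_linf x $ i\<bar>)"
    unfolding linf_norm_eq_Max by (rule Max_in) auto
  then show thesis using that by (auto simp: coord_def)
qed

lemma norm_unit: "norm (unit i) = 1"
proof (rule antisym)
  show "norm (unit i) \<le> 1" by (rule norm_linf_leI) (simp add: coord_unit)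
  show "1 \<le> norm (unit i)" using abs_coord_le[of "unit i" i] by (simp add: coord_unit)
qed

lemma linear_coord: "linear (\<lambda>x. coord x i)"
  by (rule linearI) simp_all

lemma linf_basis_expansion: "x = (\<Sum>j\<in>UNIV. coord x j *\<^sub>R unit j)"
proof (rule linf_eqI)
  fix i
  have "coord (\<Sum>j\<in>UNIV. coord x j *\<^sub>R unit j) i = (\<Sum>j\<in>UNIV. coord x j * coord (unit j) i)"
    by (simp add: linear_sum[OF linear_coord])
  also have "\<dots> = coord x i" by (simp add: coord_unit if_distrib cong: if_cong)
  finally show "coord x i = coord (\<Sum>j\<in>UNIV. coord x j *\<^sub>R unit j) i" ..
qed

text \<open>The supremum norm is comparable with the Euclidean one: the sphere is closed and bounded
  in \<open>real ^ 'n\<close>, and the 1-Lipschitz map \<open>linf_of_vec\<close> carries its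
  compactness over.\<close>

lemma compact_sphere_linf: "compact (sphere 0 1 :: 'n::finite linf set)"
proof -
  let ?S = "{v :: real ^ 'n. infnorm v = 1}"
  have "bounded ?S"
    unfolding bounded_iff
  proof (intro exI ballI)
    fix v :: "real ^ 'n" assume "v \<in> ?S"
    then show "norm v \<le> sqrt DIM(real ^ 'n)" using norm_le_infnorm[of v] by simp
  qed
  moreover have "closed ?S"
    by (intro closed_Collect_eq continuous_intros)
  ultimately have "compact ?S" by (simp add: compact_eq_bounded_closed)
  moreover have "continuous_on ?S linf_of_vec"
  proof (rule continuous_onI)
    fix v :: "real ^ 'n" and e :: real assume "0 < e"
    have "dist (linf_of_vec w) (linf_of_vec v) \<le> dist w v" for w :: "real ^ 'n"
      by (simp add: dist_norm norm_linf.rep_eq minus_linf.rep_eq linf_of_vec_inverse infnorm_le_norm)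
    then show "\<exists>d>0. \<forall>w\<in>?S. dist w v < d \<longrightarrow> dist (linf_of_vec w) (linf_of_vec v) \<le> e"
      using \<open>0 < e\<close> by (meson less_imp_le order_trans)
  qed
  moreover have "linf_of_vec ` ?S = sphere 0 1"
  proof -
    have "x \<in> linf_of_vec ` ?S" if "norm x = 1" for x
      using that by (intro image_eqI[of _ _ "vec_of_linf x"])
        (simp_all add: vec_of_linf_inverse norm_linf.rep_eq)
    then show ?thesis by (auto simp: norm_linf.rep_eq linf_of_vec_inverse)
  qed
  ultimately show ?thesis by (metis compact_continuous_image)
qed

text \<open>Conjugation with the linear bijection \<open>vec_of_linf\<close> moves the claim to
  \<open>real ^ 'n\<close>. It makes isometries invertible.\<close>

lemma linf_injective_imp_surjective:
  fixes f :: "'n::finite linf \<Rightarrow> 'n linf"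
  assumes "linear f" "inj f"
  shows "surj f"
proof -
  define g where "g = vec_of_linf \<circ> f \<circ> linf_of_vec"
  have of_vec: "linf_of_vec (u + v) = linf_of_vec u + linf_of_vec v"
    "linf_of_vec (a *\<^sub>R v) = a *\<^sub>R linf_of_vec v" for u v :: "real ^ 'n" and a
    by (simp_all add: plus_linf.abs_eq scaleR_linf.abs_eq)
  have "linear g"
    by (rule linearI)
      (simp_all add: g_def of_vec linear_add[OF assms(1)] linear_scale[OF assms(1)]
        plus_linf.rep_eq scaleR_linf.rep_eq)
  moreover have "inj g"
    unfolding g_def
    by (intro inj_compose assms(2)) (auto intro!: injI simp: vec_of_linf_inject linf_of_vec_inject)
  ultimately have "surj g" by (rule linear_injective_imp_surjective) simp
  show ?thesis
  proof (rule surjI)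
    fix y
    show "f (linf_of_vec (inv g (vec_of_linf y))) = y"
      using surj_f_inv_f[OF \<open>surj g\<close>, of "vec_of_linf y"] by (simp add: g_def vec_of_linf_inject)
  qed
qed

text \<open>A coordinate that carries weight but is not extremal could be moved so as to push the
  modulus of \<open>t\<close> above one. This serves both directions: it admits signed coordinate
  functionals as replacement rows, and it makes off-diagonal entries vanish in the rigidity
  argument.\<close>

lemma contractive_functional_extremal:
  fixes t :: "'n::finite linf \<Rightarrow> real"
  assumes t: "linear t" "\<And>y. \<bar>t y\<bar> \<le> norm y"
    and x: "norm x \<le> 1" "\<bar>t x\<bar> = 1" and j: "t (unit j) \<noteq> 0"
  shows "coord x j = t x * sgn (t (unit j))"
proof -
  define a e where "a = t (unit j)" and "e = t x"
  have e: "e = 1 \<or> e = - 1" using x(2) by (auto simp: e_def)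
  have xj: "\<bar>coord x j\<bar> \<le> 1" using abs_coord_le[of x j] x(1) by simp
  \<comment> \<open>Overwriting the \<open>j\<close>-th entry of \<open>x\<close> by its claimed value cannot increase \<open>\<bar>t\<bar>\<close> beyond one.\<close>
  define y where "y = x + (e * sgn a - coord x j) *\<^sub>R unit j"
  have "\<bar>coord y i\<bar> \<le> 1" for i
    using abs_coord_le[of x i] x(1) e by (auto simp: y_def coord_unit sgn_if)
  then have "norm y \<le> 1" by (rule norm_linf_leI)
  moreover have "t y = e + (e * sgn a - coord x j) * a"
    by (simp add: y_def a_def e_def linear_add[OF t(1)] linear_scale[OF t(1)])
  ultimately have le: "\<bar>e + (e * sgn a - coord x j) * a\<bar> \<le> 1" using t(2)[of y] by simp
  \<comment> \<open>The term added to 1 is nonnegative because \<open>coord x j\<close> has modulus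
    at most one, so the bound \<open>le\<close> forces it to be zero.\<close>
  have "e + (e * sgn a - coord x j) * a = e * (1 + (\<bar>a\<bar> - e * coord x j * a))"
    using e by (auto simp: algebra_simps abs_sgn)
  then have "\<bar>1 + (\<bar>a\<bar> - e * coord x j * a)\<bar> \<le> 1" using le e by (auto simp: abs_mult)
  moreover have "\<bar>e * coord x j * a\<bar> \<le> \<bar>a\<bar>"
    using mult_right_mono[OF xj, of "\<bar>a\<bar>"] e by (auto simp: abs_mult)
  ultimately have "e * coord x j * a = \<bar>a\<bar>" by linarith
  then have "e * coord x j * a = sgn a * a" by (simp add: abs_sgn mult.commute)
  then have "e * coord x j = sgn a" using j by (simp add: a_def)
  then show ?thesis using e by (auto simp: a_def e_def)
qed

section \<open>Operators with the same set of norm attainment\<close>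

text \<open>By compactness \<open>norm (T x)\<close> has a maximum on the sphere, and homogeneity
  turns this maximum into a bound for \<open>norm T\<close>.\<close>

lemma norm_attainment_set_nonempty:
  fixes T :: "'n::finite linf \<Rightarrow>\<^sub>L 'b::real_normed_vector"
  shows "norm_attainment_set T \<noteq> {}"
proof -
  have "unit undefined \<in> (sphere 0 1 :: 'n linf set)" by (simp add: norm_unit)
  then have ne: "sphere 0 1 \<noteq> ({} :: 'n linf set)" by blast
  have "continuous_on (sphere 0 1) (\<lambda>x. norm (T x))" by (intro continuous_intros)
  then obtain x where x: "x \<in> sphere 0 1" "\<forall>y\<in>sphere 0 1. norm (T y) \<le> norm (T x)"
    using continuous_attains_sup[OF compact_sphere_linf ne] by blast
  have "norm T \<le> norm (T x)"
  proof (rule norm_blinfun_bound)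
    fix y
    show "norm (T y) \<le> norm (T x) * norm y"
    proof (cases "y = 0")
      case False
      then have "norm (T (y /\<^sub>R norm y)) \<le> norm (T x)" by (intro x(2)[rule_format]) simp
      then show ?thesis using False
        by (simp add: blinfun.scaleR_right divide_simps mult.commute)
    qed (simp add: blinfun.zero_right)
  qed simp
  then have "norm (T x) = norm T" using norm_blinfun[of T x] x(1) by simp
  then show ?thesis using x(1) by (auto simp: norm_attainment_set_def)
qed

text \<open>The points of the sphere at distance at least \<epsilon> from the attainment set form a
  compact set \<open>?K\<close>. As \<open>T\<close> attains its norm nowhere on it,
  \<open>norm (T x)\<close> stays below one there by a positive gap, which is the required
  \<delta>.\<close>

lemma uniform_BPB_approxI:
  fixes T A :: "'n::finite linf \<Rightarrow>\<^sub>L 'b::real_normed_vector"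
  assumes "norm T = 1" "norm A = 1" "norm (T - A) < \<epsilon>" "0 < \<epsilon>"
    and same: "norm_attainment_set T = norm_attainment_set A"
  shows "uniform_BPB_approx \<epsilon> T A"
proof -
  let ?M = "norm_attainment_set A"
  let ?K = "{x \<in> sphere 0 1. \<forall>u\<in>?M. \<epsilon> \<le> norm (u - x)}"
  have "\<exists>\<delta>>0. \<forall>x\<in>?K. norm (T x) \<le> 1 - \<delta>"
  proof (cases "?K = {}")
    case True
    then show ?thesis using zero_less_one by blast
  next
    case False
    have "?K = sphere 0 1 \<inter> (\<Inter>u\<in>?M. {x. \<epsilon> \<le> norm (u - x)})" by auto
    moreover have "closed (\<Inter>u\<in>?M. {x. \<epsilon> \<le> norm (u - x)})"
      by (intro closed_INT ballI closed_Collect_le continuous_intros)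
    ultimately have "compact ?K"
      using compact_Int_closed[OF compact_sphere_linf] by metis
    moreover have "continuous_on ?K (\<lambda>x. norm (T x))" by (intro continuous_intros)
    ultimately obtain x where x: "x \<in> ?K" "\<forall>y\<in>?K. norm (T y) \<le> norm (T x)"
      using continuous_attains_sup[OF _ False] by blast
    \<comment> \<open>Otherwise \<open>x\<close> itself would be an attaining point at distance
      zero.\<close>
    have "x \<notin> norm_attainment_set T" unfolding same using x(1) \<open>0 < \<epsilon>\<close> by force
    then have "norm (T x) \<noteq> 1" using x(1) \<open>norm T = 1\<close> by (simp add: norm_attainment_set_def)
    moreover have "norm (T x) \<le> 1" using norm_blinfun[of T x] x(1) \<open>norm T = 1\<close> by simp
    ultimately show ?thesis using x(2) by (intro exI[of _ "1 - norm (T x)"]) auto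
  qed
  then obtain \<delta> where "\<delta> > 0" "\<And>x. x \<in> ?K \<Longrightarrow> norm (T x) \<le> 1 - \<delta>" by blast
  then show ?thesis
    using assms unfolding uniform_BPB_approx_def by (force simp: not_le)
qed

section \<open>Rows of an operator as contractive functionals\<close>

lemma row_bound:
  fixes T :: "'n::finite linf \<Rightarrow>\<^sub>L 'm::finite linf"
  assumes "norm T = 1"
  shows "\<bar>coord (T x) i\<bar> \<le> norm x"
  using norm_blinfun[of T x] abs_coord_le[of "T x" i] assms by simp

lemma linear_row:
  fixes T :: "'n::finite linf \<Rightarrow>\<^sub>L 'm::finite linf"
  shows "linear (\<lambda>x. coord (T x) i)"
  by (rule linearI) (simp_all add: blinfun.add_right blinfun.scaleR_right)

lemma mem_norm_attainment_set_iff: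
  fixes T :: "'n::finite linf \<Rightarrow>\<^sub>L 'm::finite linf"
  assumes "norm T = 1"
  shows "x \<in> norm_attainment_set T \<longleftrightarrow> norm x = 1 \<and> (\<exists>i. \<bar>coord (T x) i\<bar> = 1)"
proof -
  have "(norm (T x) = 1) = (\<exists>i. \<bar>coord (T x) i\<bar> = 1)" if "norm x = 1"
  proof
    assume "norm (T x) = 1"
    then show "\<exists>i. \<bar>coord (T x) i\<bar> = 1" by (metis norm_linf_attained)
  next
    assume "\<exists>i. \<bar>coord (T x) i\<bar> = 1"
    then have "1 \<le> norm (T x)" by (metis abs_coord_le)
    then show "norm (T x) = 1" using norm_blinfun[of T x] that assms by simp
  qed
  then show ?thesis by (auto simp: norm_attainment_set_def assms)
qed

text \<open>Row \<open>i\<close> becomes a convex combination of itself and \<open>w\<close>.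
  Convexity keeps the norm at most one and adds no attaining points; \<open>cover\<close> ensures
  that none is lost.\<close>

lemma replace_row:
  fixes T :: "'n::finite linf \<Rightarrow>\<^sub>L 'm::finite linf"
  assumes T: "norm T = 1" and "0 < \<epsilon>"
    and w: "linear w" "\<And>x. \<bar>w x\<bar> \<le> norm x" "w \<noteq> (\<lambda>x. coord (T x) i)"
    and cover: "\<And>x. norm x = 1 \<Longrightarrow> \<bar>coord (T x) i\<bar> = 1 \<Longrightarrow>
      w x = coord (T x) i \<or> (\<exists>k. k \<noteq> i \<and> \<bar>coord (T x) k\<bar> = 1)"
  shows "\<exists>A. nontrivial_uniform_BPB_approx \<epsilon> T A \<and> norm_attainment_set T = norm_attainment_set A"
proof -
  \<comment> \<open>Two contractive functionals differ by at most 2 on the sphere, hence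
    \<open>2 * \<eta> < \<epsilon>\<close>; \<open>\<eta> < 1\<close> keeps a positive weight on the
    old row.\<close>
  define \<eta> where "\<eta> = min (1/2) (\<epsilon>/4)"
  have \<eta>: "0 < \<eta>" "\<eta> < 1" "2 * \<eta> < \<epsilon>" using \<open>0 < \<epsilon>\<close> by (auto simp: \<eta>_def)
  define D where "D = (\<lambda>x. (\<eta> * (w x - coord (T x) i)) *\<^sub>R unit i)"
  have D_le: "norm (D x) \<le> 2 * \<eta> * norm x" for x
  proof -
    have "\<bar>w x - coord (T x) i\<bar> \<le> 2 * norm x" using w(2)[of x] row_bound[OF T, of x i] by linarith
    then show ?thesis using \<eta> by (simp add: D_def norm_unit abs_mult)
  qed
  have "bounded_linear D"
    by (rule bounded_linear_intro[OF _ _ D_le[unfolded mult.commute[of _ "norm _"]]])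
      (simp_all add: D_def linear_add[OF w(1)] linear_scale[OF w(1)] blinfun.add_right
        blinfun.scaleR_right algebra_simps)
  define A where "A = T + Blinfun D"
  have A_apply: "A x = T x + D x" for x
    by (simp add: A_def blinfun.add_left bounded_linear_Blinfun_apply \<open>bounded_linear D\<close>)
  have row: "coord (A x) k = (if k = i then (1 - \<eta>) * coord (T x) i + \<eta> * w x else coord (T x) k)"
    for x k
    by (simp add: A_apply D_def coord_unit algebra_simps)
  have row_i: "\<bar>coord (A x) i\<bar> \<le> (1 - \<eta>) * \<bar>coord (T x) i\<bar> + \<eta> * \<bar>w x\<bar>" for x
    using \<eta> abs_triangle_ineq[of "(1 - \<eta>) * coord (T x) i" "\<eta> * w x"] by (simp add: row abs_mult)
  have A_le: "norm (A x) \<le> norm x" for x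
  proof (rule norm_linf_leI)
    fix k
    have "(1 - \<eta>) * \<bar>coord (T x) i\<bar> + \<eta> * \<bar>w x\<bar> \<le> norm x"
      using \<eta> w(2)[of x] row_bound[OF T, of x i] by (intro convex_bound_le) auto
    then show "\<bar>coord (A x) k\<bar> \<le> norm x"
      using row_bound[OF T, of x k] row_i[of x] by (cases "k = i") (simp, simp add: row)
  qed
  have attain: "(\<exists>k. \<bar>coord (A x) k\<bar> = 1) \<longleftrightarrow> (\<exists>k. \<bar>coord (T x) k\<bar> = 1)" if x: "norm x = 1" for x
  proof
    assume "\<exists>k. \<bar>coord (A x) k\<bar> = 1"
    then obtain k where k: "\<bar>coord (A x) k\<bar> = 1" ..
    show "\<exists>k. \<bar>coord (T x) k\<bar> = 1"
    proof (cases "k = i")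
      case True
      \<comment> \<open>The share of \<open>w\<close> is at most \<eta>, so modulus one in the new
        row needs the full share \<open>1 - \<eta>\<close> from the old one.\<close>
      have "\<eta> * \<bar>w x\<bar> \<le> \<eta>" using \<eta> w(2)[of x] x by simp
      then have "(1 - \<eta>) * 1 \<le> (1 - \<eta>) * \<bar>coord (T x) i\<bar>" using row_i[of x] k True by simp
      then have "1 \<le> \<bar>coord (T x) i\<bar>" using \<eta> by (simp only: mult_le_cancel_left_pos diff_gt_0_iff_gt)
      then show ?thesis using row_bound[OF T, of x i] x by (intro exI[of _ i]) simp
    qed (use k row in auto)
  next
    assume "\<exists>k. \<bar>coord (T x) k\<bar> = 1"
    then obtain k where k: "\<bar>coord (T x) k\<bar> = 1" ..
    \<comment> \<open>Another attaining row is untouched; if row \<open>i\<close> attains alone,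
      \<open>cover\<close> makes \<open>w\<close> agree with it at \<open>x\<close>, and so does
      their combination.\<close>
    show "\<exists>k. \<bar>coord (A x) k\<bar> = 1"
    proof (cases "\<exists>k. k \<noteq> i \<and> \<bar>coord (T x) k\<bar> = 1")
      case True
      then show ?thesis using row by metis
    next
      case False
      then have "k = i" using k by blast
      then have "w x = coord (T x) i" using cover[OF x] k False by blast
      then have "coord (A x) i = coord (T x) i" by (simp add: row algebra_simps)
      then show ?thesis using k \<open>k = i\<close> by metis
    qed
  qed
  have "norm A = 1"
  proof (rule antisym)
    show "norm A \<le> 1" by (rule norm_blinfun_bound) (simp_all add: A_le)
    obtain x where "x \<in> norm_attainment_set T" using norm_attainment_set_nonempty by blast
    then have x: "norm x = 1" "\<exists>i. \<bar>coord (T x) i\<bar> = 1"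
      by (simp_all add: mem_norm_attainment_set_iff[OF T])
    then obtain k where "\<bar>coord (A x) k\<bar> = 1" using attain by blast
    then show "1 \<le> norm A" using abs_coord_le[of "A x" k] norm_blinfun[of A x] x(1) by simp
  qed
  have same: "norm_attainment_set T = norm_attainment_set A"
  proof (rule set_eqI)
    fix x
    show "x \<in> norm_attainment_set T \<longleftrightarrow> x \<in> norm_attainment_set A"
      unfolding mem_norm_attainment_set_iff[OF T] mem_norm_attainment_set_iff[OF \<open>norm A = 1\<close>]
      using attain[of x] by blast
  qed
  have "norm (T - A) \<le> 2 * \<eta>"
  proof (rule norm_blinfun_bound)
    show "norm ((T - A) x) \<le> 2 * \<eta> * norm x" for x
      using D_le[of x] by (simp add: blinfun.diff_left A_apply)
  qed (use \<eta> in simp)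
  then have "uniform_BPB_approx \<epsilon> T A"
    using T \<open>norm A = 1\<close> \<open>0 < \<epsilon>\<close> same \<eta>(3) by (intro uniform_BPB_approxI) simp_all
  moreover have "A \<noteq> T"
  proof
    assume "A = T"
    then have "D x = 0" for x using A_apply[of x] by simp
    then have "\<eta> * (w x - coord (T x) i) = 0" for x
      using norm_unit[of i] by (metis D_def norm_zero scaleR_eq_0_iff zero_neq_one)
    then show False using w(3) \<eta>(1) by auto
  qed
  ultimately show ?thesis using same unfolding nontrivial_uniform_BPB_approx_def by blast
qed

text \<open>An injective \<open>\<sigma>\<close> on a finite index type is a permutation, so
  \<open>T\<close> only permutes coordinates and changes signs.\<close>

lemma signed_coordinates_Iso:
  fixes T :: "'n::finite linf \<Rightarrow>\<^sub>L 'n linf"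
  assumes rows: "\<And>i x. coord (T x) i = s i * coord x (\<sigma> i)"
    and s: "\<And>i. \<bar>s i\<bar> = 1" and "inj \<sigma>"
  shows "T \<in> Iso"
proof -
  have "norm (T x) = norm x" for x
  proof (rule antisym)
    show "norm (T x) \<le> norm x"
      by (rule norm_linf_leI) (simp add: rows abs_mult s abs_coord_le)
    show "norm x \<le> norm (T x)"
    proof (rule norm_linf_leI)
      fix j
      obtain i where "j = \<sigma> i"
        using finite_UNIV_inj_surj[OF finite \<open>inj \<sigma>\<close>] by (metis surjD)
      then show "\<bar>coord x j\<bar> \<le> norm (T x)"
        using abs_coord_le[of "T x" i] by (simp add: rows abs_mult s)
    qed
  qed
  then show ?thesis by (simp add: Iso_def)
qed

lemma nontrivial_approximation:
  fixes T :: "'n::finite linf \<Rightarrow>\<^sub>L 'n linf"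
  assumes T: "norm T = 1" and "T \<notin> Iso" "0 < \<epsilon>"
  shows "\<exists>A. nontrivial_uniform_BPB_approx \<epsilon> T A \<and> norm_attainment_set T = norm_attainment_set A"
proof (rule ccontr)
  assume none: "\<not> ?thesis"
  note replace = replace_row[OF T \<open>0 < \<epsilon>\<close>]
  \<comment> \<open>If every attaining point of row \<open>i\<close> were shared with another row,
    \<open>cover\<close> would hold for any contractive \<open>w\<close>.\<close>
  have ex_x: "\<exists>x. norm x = 1 \<and> \<bar>coord (T x) i\<bar> = 1 \<and> (\<forall>k. k \<noteq> i \<longrightarrow> \<bar>coord (T x) k\<bar> \<noteq> 1)" for i
  proof (rule ccontr)
    assume redundant: "\<not> ?thesis"
    \<comment> \<open>The new row must differ from the old one: zero does unless the row is zero,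
      and then the \<open>i\<close>-th coordinate does.\<close>
    obtain w :: "'n linf \<Rightarrow> real" where
      "linear w" "\<And>x. \<bar>w x\<bar> \<le> norm x" "w \<noteq> (\<lambda>x. coord (T x) i)"
    proof (cases "(\<lambda>x. coord (T x) i) = (\<lambda>x. 0)")
      case True
      have "coord (unit i) i \<noteq> 0" by (simp add: coord_unit)
      then have "(\<lambda>x. coord x i) \<noteq> (\<lambda>x. coord (T x) i)" unfolding True by metis
      then show ?thesis using that[OF linear_coord abs_coord_le] by blast
    next
      case False
      show ?thesis by (rule that[of "\<lambda>x. 0"]) (use False in \<open>auto simp: linear_zero\<close>)
    qed
    from replace[OF this] show False using redundant none by blast
  qed
  \<comment> \<open>By extremality the signed coordinate functional agrees with row \<open>i\<close>
    wherever that row attains, so it is an admissible replacement and must be the row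
    itself.\<close>
  have row_eq: "coord (T x) i = sgn (coord (T (unit j)) i) * coord x j"
    if j: "coord (T (unit j)) i \<noteq> 0" for i j x
  proof -
    let ?w = "\<lambda>x. sgn (coord (T (unit j)) i) * coord x j"
    have s: "\<bar>sgn (coord (T (unit j)) i)\<bar> = 1" using j by (simp add: abs_sgn_eq)
    have "?w = (\<lambda>x. coord (T x) i)"
    proof (rule ccontr)
      assume ne: "?w \<noteq> (\<lambda>x. coord (T x) i)"
      have "linear ?w" by (rule linearI) (simp_all add: algebra_simps)
      moreover have "\<bar>?w x\<bar> \<le> norm x" for x by (simp add: abs_mult s abs_coord_le)
      moreover have "?w x = coord (T x) i" if "norm x = 1" "\<bar>coord (T x) i\<bar> = 1" for x
        using contractive_functional_extremal[OF linear_row row_bound[OF T], of x i j] that j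
        by (simp add: sgn_if)
      ultimately show False using replace[OF _ _ ne] none by blast
    qed
    then show ?thesis by (metis (no_types))
  qed
  have "\<exists>j. coord (T (unit j)) i \<noteq> 0" for i
  proof (rule ccontr)
    assume zero: "\<not> ?thesis"
    obtain x where "\<bar>coord (T x) i\<bar> = 1" using ex_x by blast
    moreover have "coord (T x) i = (\<Sum>j\<in>UNIV. coord x j * coord (T (unit j)) i)"
      by (subst linf_basis_expansion[of x])
        (simp add: linear_sum[OF linear_row] blinfun.scaleR_right)
    ultimately show False using zero by simp
  qed
  then obtain \<sigma> where \<sigma>: "\<And>i. coord (T (unit (\<sigma> i))) i \<noteq> 0" by metis
  define s where "s i = sgn (coord (T (unit (\<sigma> i))) i)" for i
  have s: "\<bar>s i\<bar> = 1" for i using \<sigma>[of i] by (simp add: s_def abs_sgn_eq)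
  have rows: "coord (T x) i = s i * coord x (\<sigma> i)" for x i unfolding s_def by (rule row_eq[OF \<sigma>])
  \<comment> \<open>Rows reading the same coordinate have equal modulus everywhere, so neither could
    attain alone.\<close>
  have "inj \<sigma>"
  proof (rule injI, rule ccontr)
    fix i k assume "\<sigma> i = \<sigma> k" "i \<noteq> k"
    moreover obtain x where "\<bar>coord (T x) i\<bar> = 1" "\<forall>k. k \<noteq> i \<longrightarrow> \<bar>coord (T x) k\<bar> \<noteq> 1" using ex_x by blast
    ultimately show False by (auto simp: rows abs_mult s)
  qed
  then show False using signed_coordinates_Iso[OF rows s] \<open>T \<notin> Iso\<close> by blast
qed

section \<open>Rigidity of isometries\<close>

text \<open>Near \<open>unit i\<close> the norm can be attained only in row \<open>i\<close>. The
  other coordinates of the attaining point are too small to be extremal, so row \<open>i\<close> has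
  only its diagonal entry, which must be one.\<close>

lemma near_identity_rigidity:
  fixes B :: "'n::finite linf \<Rightarrow> 'n linf"
  assumes B: "linear B" "\<And>x. norm (B x) \<le> norm x" and near: "\<And>x. norm (B x - x) \<le> norm x / 2"
    and attained: "\<And>i. \<exists>u. norm u = 1 \<and> norm (B u) = 1 \<and> norm (u - unit i) < 1/2"
  shows "B x = x"
proof (rule linf_eqI)
  fix i
  obtain u where u: "norm u = 1" "norm (B u) = 1" "norm (u - unit i) < 1/2"
    using attained by blast
  have u_small: "\<bar>coord u j\<bar> < 1/2" if "j \<noteq> i" for j
    using abs_coord_le[of "u - unit i" j] u(3) that by (simp add: coord_unit)
  obtain k where k: "\<bar>coord (B u) k\<bar> = 1" using norm_linf_attained u(2) by metis
  \<comment> \<open>In any other row \<open>B u\<close> has modulus less than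
    \<open>1/2 + 1/2\<close>.\<close>
  have "k = i"
    using abs_coord_le[of "B u - u" k] near[of u] u(1) u_small[of k] k by fastforce
  have lin: "linear (\<lambda>x. coord (B x) i)"
    by (rule linearI) (simp_all add: linear_add[OF B(1)] linear_scale[OF B(1)])
  have bound: "\<bar>coord (B x) i\<bar> \<le> norm x" for x using abs_coord_le B(2) order_trans by blast
  have off_diag: "coord (B (unit j)) i = 0" if "j \<noteq> i" for j
  proof (rule ccontr)
    assume nz: "coord (B (unit j)) i \<noteq> 0"
    have "coord u j = coord (B u) i * sgn (coord (B (unit j)) i)"
      by (rule contractive_functional_extremal[OF lin bound]) (use u k nz \<open>k = i\<close> in auto)
    then have "\<bar>coord u j\<bar> = 1" using k \<open>k = i\<close> nz by (simp add: abs_mult abs_sgn_eq)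
    then show False using u_small[OF that] by simp
  qed
  have B_i: "coord (B y) i = coord y i * coord (B (unit i)) i" for y
  proof -
    have "coord (B y) i = (\<Sum>j\<in>UNIV. coord y j * coord (B (unit j)) i)"
      by (subst linf_basis_expansion[of y])
        (simp add: linear_sum[OF lin] linear_scale[OF B(1)])
    also have "\<dots> = (\<Sum>j\<in>{i}. coord y j * coord (B (unit j)) i)"
      by (rule sum.mono_neutral_right) (auto simp: off_diag)
    finally show ?thesis by simp
  qed
  define b where "b = coord (B (unit i)) i"
  have "\<bar>coord u i\<bar> * \<bar>b\<bar> = 1" using k \<open>k = i\<close> B_i[of u] by (simp add: abs_mult b_def)
  moreover have "\<bar>coord u i\<bar> * \<bar>b\<bar> \<le> 1 * \<bar>b\<bar>"
    by (rule mult_right_mono) (use abs_coord_le[of u i] u(1) in auto)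
  moreover have "\<bar>b\<bar> \<le> 1" using bound[of "unit i"] by (simp add: b_def norm_unit)
  moreover have "\<bar>b - 1\<bar> \<le> 1/2"
    using abs_coord_le[of "B (unit i) - unit i" i] near[of "unit i"]
    by (simp add: b_def norm_unit coord_unit)
  \<comment> \<open>The first three facts give modulus one; closeness to 1 excludes -1.\<close>
  ultimately have "b = 1" by linarith
  then show "coord (B x) i = coord x i" using B_i[of x] by (simp add: b_def)
qed

text \<open>The inverse of \<open>T\<close> is again an isometry, so composing it with
  \<open>A\<close> preserves norms, attaining points and the distance to \<open>T\<close>; the bound
  1/2 is the one the rigidity argument needs.\<close>

lemma Iso_approximation_unique:
  fixes T A :: "'n::finite linf \<Rightarrow>\<^sub>L 'n linf"
  assumes "T \<in> Iso" "\<epsilon> \<le> 1/2" and approx: "uniform_BPB_approx \<epsilon> T A"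
  shows "A = T"
proof -
  have iso: "norm (T x) = norm x" for x using \<open>T \<in> Iso\<close> by (simp add: Iso_def)
  have linT: "linear T" and linA: "linear A"
    by (simp_all add: blinfun.bounded_linear_right bounded_linear.linear)
  have "inj T"
  proof (rule injI)
    fix x y assume "T x = T y"
    then have "norm (x - y) = 0" using iso[of "x - y"] by (simp add: blinfun.diff_right)
    then show "x = y" by simp
  qed
  then have "surj T" using linf_injective_imp_surjective linT by blast
  define S where "S = inv T"
  have TS: "T (S y) = y" for y using \<open>surj T\<close> by (simp add: S_def surj_f_inv_f)
  have normS: "norm (S y) = norm y" for y using iso[of "S y"] by (simp add: TS)
  have "linear S"
    by (rule linearI; rule injD[OF \<open>inj T\<close>])
      (simp_all add: TS blinfun.add_right blinfun.scaleR_right)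
  have A: "norm A = 1" "norm (T - A) < 1/2" and "\<exists>\<delta>>0. \<forall>x0\<in>sphere 0 1. norm (T x0) > 1 - \<delta> \<longrightarrow>
      (\<exists>u0\<in>norm_attainment_set A. norm (u0 - x0) < \<epsilon>)"
    using approx \<open>\<epsilon> \<le> 1/2\<close> unfolding uniform_BPB_approx_def by auto
  \<comment> \<open>An isometry has \<open>norm (T x) = 1 > 1 - \<delta>\<close> on the whole
    sphere, so the approximation condition applies at every point, whatever \<delta> is.\<close>
  then have dense: "\<exists>u\<in>norm_attainment_set A. norm (u - x) < \<epsilon>" if "norm x = 1" for x
    using that iso by (metis diff_less_eq less_add_same_cancel1 mem_sphere_0)
  have "S (A x) = x" for x
  proof (rule near_identity_rigidity[where B = "\<lambda>x. S (A x)"])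
    show "linear (\<lambda>x. S (A x))" using linear_compose[OF linA \<open>linear S\<close>] by (simp add: comp_def)
    show "norm (S (A x)) \<le> norm x" for x using norm_blinfun[of A x] A(1) by (simp add: normS)
    show "norm (S (A x) - x) \<le> norm x / 2" for x
    proof -
      have "norm (S (A x) - x) = norm (A x - T x)"
        using iso[of "S (A x) - x"] by (simp add: blinfun.diff_right TS)
      also have "\<dots> = norm ((T - A) x)" by (simp add: blinfun.diff_left norm_minus_commute)
      also have "\<dots> \<le> norm (T - A) * norm x" by (rule norm_blinfun)
      also have "\<dots> \<le> 1/2 * norm x" using A(2) by (intro mult_right_mono) auto
      finally show ?thesis by simp
    qed
    show "\<exists>u. norm u = 1 \<and> norm (S (A u)) = 1 \<and> norm (u - unit i) < 1/2" for i
      using dense[OF norm_unit, of i] \<open>\<epsilon> \<le> 1/2\<close> A(1)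
      by (force simp: norm_attainment_set_def normS)
  qed
  then have "A x = T x" for x using TS by metis
  then show "A = T" by (rule blinfun_eqI)
qed

theorem corollary4p3:
  shows "(\<forall>T :: 'n::finite linf \<Rightarrow>\<^sub>L 'n linf. T \<in> sphere 0 1 \<longrightarrow>
            (T \<in> Iso \<longleftrightarrow>
              (\<exists>\<epsilon>0>0. \<forall>\<epsilon>. 0 < \<epsilon> \<and> \<epsilon> < \<epsilon>0 \<longrightarrow> {A. uniform_BPB_approx \<epsilon> T A} = {T})))
         \<and> nontrivial_norm_preserving_uniform_BPB_property TYPE('n linf) TYPE('n linf)"
proof (intro conjI allI impI iffI)
  fix T :: "'n linf \<Rightarrow>\<^sub>L 'n linf"
  assume "T \<in> sphere 0 1"
  then have T: "norm T = 1" by simp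
  show "\<exists>\<epsilon>0>0. \<forall>\<epsilon>. 0 < \<epsilon> \<and> \<epsilon> < \<epsilon>0 \<longrightarrow> {A. uniform_BPB_approx \<epsilon> T A} = {T}" if "T \<in> Iso"
  proof (intro exI[of _ "1/2"] conjI allI impI)
    fix \<epsilon> :: real assume \<epsilon>: "0 < \<epsilon> \<and> \<epsilon> < 1/2"
    \<comment> \<open>Uniqueness alone would allow the empty set; \<open>T\<close> approximates
      itself because its norm attainment set trivially agrees with itself.\<close>
    then have "uniform_BPB_approx \<epsilon> T T" by (intro uniform_BPB_approxI) (simp_all add: T)
    then show "{A. uniform_BPB_approx \<epsilon> T A} = {T}"
      using Iso_approximation_unique[OF that] \<epsilon> by (auto intro: less_imp_le)
  qed simp
  show "T \<in> Iso" if only: "\<exists>\<epsilon>0>0. \<forall>\<epsilon>. 0 < \<epsilon> \<and> \<epsilon> < \<epsilon>0 \<longrightarrow> {A. uniform_BPB_approx \<epsilon> T A} = {T}"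
  proof (rule ccontr)
    assume "T \<notin> Iso"
    obtain e where "e > 0" and unique: "\<And>\<epsilon>. 0 < \<epsilon> \<and> \<epsilon> < e \<Longrightarrow> {A. uniform_BPB_approx \<epsilon> T A} = {T}"
      using only by blast
    obtain A where "nontrivial_uniform_BPB_approx (e/2) T A"
      using nontrivial_approximation[OF T \<open>T \<notin> Iso\<close>, of "e/2"] \<open>e > 0\<close> by auto
    then show False
      using unique[of "e/2"] \<open>e > 0\<close> unfolding nontrivial_uniform_BPB_approx_def by auto
  qed
next
  show "nontrivial_norm_preserving_uniform_BPB_property TYPE('n linf) TYPE('n linf)"
    unfolding nontrivial_norm_preserving_uniform_BPB_property_def
    using nontrivial_approximation by auto
qed

end
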